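(* In the setting described in the context (the Laurent polynomial ring $S=k[x_1,\ldots,x_r,x_{r+1}^{\pm1},\ldots,x_n^{\pm1}]$ multigraded by $A$ through the matrix $L$), for all $a\in Q$ the graded component $S_a$ is finitely generated as an $S_0$-module.
   Context: $k$ is an algebraically closed field of characteristic $0$, $n=r+s$, $X=k^r\times(k^{\times})^s$, $S=k[x_1,\ldots,x_r,x_{r+1}^{\pm1},\ldots,x_n^{\pm1}]$. $H=(k^\times)^p\times\mathbb{F}$ with $\mathbb{F}$ a product of cyclic groups of orders $d_1,\ldots,d_t$; $m=p+t$; the character group $A=\mathrm{Hom}(H,k^\times)$ is identified with $\mathbb{Z}^p\oplus\mathbb{Z}/d_1\mathbb{Z}\oplus\cdots\oplus\mathbb{Z}/d_t\mathbb{Z}$. $H$ acts diagonally and faithfully on $X$ with weights $\eta_1,\ldots,\eta_n\in A$ ($h$ multiplies the $i$-th coordinate by $\eta_i(h)$), and $L$ is the $m\times n$ integer matrix whose $i$-th column represents $\eta_i$. The degree map is $\deg:\mathbb{Z}^n\to A$, $\deg(\lambda)=L\lambda$ (read in $A$), i.e. $\deg(\lambda)=\sum\lambda_i\eta_i$. For $a\in A$, $S_a=\mathrm{span}_k\{x^\lambda\in S\mid L\lambda=a\}$; $S_0$ is a subring of $S$ and each $S_a$ is an $S_0$-module by multiplication in $S$. $Q=\deg(\mathbb{N}^r\times\mathbb{Z}^s)\subseteq A$, with $0\in\mathbb{N}$. *)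

theory Defs
  imports
    "HOL-Algebra.Algebra"
    "HOL-Algebra.Algebraic_Closure_Type"
    "HOL-Library.Poly_Mapping"
begin

text \<open>
  Indices are 0-based: coordinates of the space are indexed by \<open>i < r + s\<close> (the last \<open>s\<close> of them are
  invertible), factors of the acting group by \<open>j < p + t\<close> (the first \<open>p\<close> of them are \<open>k\<^sup>\<times>\<close>, the
  \<open>j\<close>-th one with \<open>p \<le> j\<close> is cyclic of order \<open>d (j - p)\<close>).
\<close>

text \<open>The modulus \<open>0\<close> stands for a free factor: \<^term>\<open>integer_mod_group 0\<close> is \<open>\<int>\<close>, and \<open>x mod 0 = x\<close>.\<close>

definition modulus :: "nat \<Rightarrow> (nat \<Rightarrow> nat) \<Rightarrow> nat \<Rightarrow> nat" where
  "modulus p d j = (if j < p then 0 else d (j - p))"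

text \<open>The group \<open>A = \<int>\<^sup>p \<oplus> \<int>/d\<^sub>1 \<oplus> \<dots> \<oplus> \<int>/d\<^sub>t\<close> and the projection \<open>\<int>\<^sup>p\<^sup>+\<^sup>t \<rightarrow> A\<close>.\<close>

definition weight_group :: "nat \<Rightarrow> nat \<Rightarrow> (nat \<Rightarrow> nat) \<Rightarrow> (nat \<Rightarrow> int) monoid" where
  "weight_group p t d = product_group {..<p + t} (\<lambda>j. integer_mod_group (modulus p d j))"

definition weight_class :: "nat \<Rightarrow> nat \<Rightarrow> (nat \<Rightarrow> nat) \<Rightarrow> (nat \<Rightarrow> int) \<Rightarrow> (nat \<Rightarrow> int)" where
  "weight_class p t d v = (\<lambda>j\<in>{..<p + t}. v j mod int (modulus p d j))"

text \<open>
  The group \<open>H\<close>. Over an algebraically closed field of characteristic \<open>0\<close> the \<open>e\<close>-th roots of unity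
  form a cyclic group of order \<open>e\<close> (\<open>e > 0\<close>); this model of the cyclic factors makes the
  identification of the characters of \<open>H\<close> with \<open>A\<close> canonical: \<open>a\<close> corresponds to
  \<open>h \<mapsto> \<Prod>\<^sub>j h\<^sub>j\<^bsup>a\<^sub>j\<^esup>\<close>.
\<close>

definition roots_of_unity_group :: "nat \<Rightarrow> 'k::field monoid" where
  "roots_of_unity_group e =
     \<lparr>carrier = {z. z ^ e = 1}, monoid.mult = (*), monoid.one = 1\<rparr>"

definition acting_group :: "nat \<Rightarrow> nat \<Rightarrow> (nat \<Rightarrow> nat) \<Rightarrow> (nat \<Rightarrow> 'k::field) monoid" where
  "acting_group p t d = product_group {..<p + t}
     (\<lambda>j. if j < p then units_of ring_of_type_algebra else roots_of_unity_group (d (j - p)))"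

definition char_of_weight :: "nat \<Rightarrow> nat \<Rightarrow> (nat \<Rightarrow> int) \<Rightarrow> (nat \<Rightarrow> 'k::field) \<Rightarrow> 'k" where
  "char_of_weight p t a h = (\<Prod>j<p + t. h j powi a j)"

definition affine_torus_space :: "nat \<Rightarrow> nat \<Rightarrow> (nat \<Rightarrow> 'k::field) set" where
  "affine_torus_space r s = (\<Pi>\<^sub>E i\<in>{..<r + s}. if i < r then UNIV else UNIV - {0})"

definition diagonal_action ::
    "nat \<Rightarrow> nat \<Rightarrow> nat \<Rightarrow> nat \<Rightarrow> (nat \<Rightarrow> nat \<Rightarrow> int) \<Rightarrow>
     (nat \<Rightarrow> 'k::field) \<Rightarrow> (nat \<Rightarrow> 'k) \<Rightarrow> (nat \<Rightarrow> 'k)" where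
  "diagonal_action r s p t \<eta> h =
     (\<lambda>x\<in>affine_torus_space r s. \<lambda>i\<in>{..<r + s}. char_of_weight p t (\<eta> i) h * x i)"

text \<open>
  Exponent vectors in \<open>\<int>\<^sup>r\<^sup>+\<^sup>s\<close> are finitely supported maps \<^typ>\<open>nat \<Rightarrow>\<^sub>0 int\<close>. The type
  \<open>(nat \<Rightarrow>\<^sub>0 int) \<Rightarrow>\<^sub>0 'k\<close> carries the convolution product, so it is the ring of Laurent polynomials
  in countably many variables, with \<^term>\<open>Poly_Mapping.single l c\<close> standing for \<open>c x\<^sup>l\<close>.
\<close>

definition exponents :: "nat \<Rightarrow> nat \<Rightarrow> (nat \<Rightarrow>\<^sub>0 int) set" where
  "exponents r s = {l. Poly_Mapping.keys l \<subseteq> {..<r + s} \<and> (\<forall>i<r. 0 \<le> Poly_Mapping.lookup l i)}"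

definition laurent_ring :: "nat \<Rightarrow> nat \<Rightarrow> ((nat \<Rightarrow>\<^sub>0 int) \<Rightarrow>\<^sub>0 'k::field) ring" where
  "laurent_ring r s = ring_of_type_algebra\<lparr>carrier := {f. Poly_Mapping.keys f \<subseteq> exponents r s}\<rparr>"

definition weight_degree ::
    "nat \<Rightarrow> nat \<Rightarrow> nat \<Rightarrow> (nat \<Rightarrow> nat) \<Rightarrow> (nat \<Rightarrow> nat \<Rightarrow> int) \<Rightarrow> (nat \<Rightarrow>\<^sub>0 int) \<Rightarrow> (nat \<Rightarrow> int)" where
  "weight_degree n p t d L l = weight_class p t d (\<lambda>j. \<Sum>i<n. L j i * Poly_Mapping.lookup l i)"

definition graded_component ::
    "nat \<Rightarrow> nat \<Rightarrow> nat \<Rightarrow> nat \<Rightarrow> (nat \<Rightarrow> nat) \<Rightarrow> (nat \<Rightarrow> nat \<Rightarrow> int) \<Rightarrow> (nat \<Rightarrow> int) \<Rightarrow>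
     ((nat \<Rightarrow>\<^sub>0 int) \<Rightarrow>\<^sub>0 'k::field) set" where
  "graded_component r s p t d L a =
     Modules.module.span (\<lambda>c f. Poly_Mapping.single 0 c * f)
       {Poly_Mapping.single l 1 | l. l \<in> exponents r s \<and> weight_degree (r + s) p t d L l = a}"

definition degree_zero_ring ::
    "nat \<Rightarrow> nat \<Rightarrow> nat \<Rightarrow> nat \<Rightarrow> (nat \<Rightarrow> nat) \<Rightarrow> (nat \<Rightarrow> nat \<Rightarrow> int) \<Rightarrow>
     ((nat \<Rightarrow>\<^sub>0 int) \<Rightarrow>\<^sub>0 'k::field) ring" where
  "degree_zero_ring r s p t d L =
     (laurent_ring r s)\<lparr>carrier := graded_component r s p t d L \<one>\<^bsub>weight_group p t d\<^esub>\<rparr>"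

text \<open>The fields \<open>mult\<close> and \<open>one\<close> of the record are irrelevant for the module structure.\<close>

definition graded_module ::
    "nat \<Rightarrow> nat \<Rightarrow> nat \<Rightarrow> nat \<Rightarrow> (nat \<Rightarrow> nat) \<Rightarrow> (nat \<Rightarrow> nat \<Rightarrow> int) \<Rightarrow> (nat \<Rightarrow> int) \<Rightarrow>
     ((nat \<Rightarrow>\<^sub>0 int) \<Rightarrow>\<^sub>0 'k::field, (nat \<Rightarrow>\<^sub>0 int) \<Rightarrow>\<^sub>0 'k) module" where
  "graded_module r s p t d L a =
     \<lparr>carrier = graded_component r s p t d L a,
      monoid.mult = monoid.mult (laurent_ring r s), monoid.one = \<one>\<^bsub>laurent_ring r s\<^esub>,
      ring.zero = \<zero>\<^bsub>laurent_ring r s\<^esub>, ring.add = ring.add (laurent_ring r s),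
      module.smult = monoid.mult (laurent_ring r s)\<rparr>"

definition finitely_generated_module ::
    "('a, 'c) ring_scheme \<Rightarrow> ('a, 'b, 'e) module_scheme \<Rightarrow> bool" where
  "finitely_generated_module R M \<longleftrightarrow>
     Module.module R M \<and>
     (\<exists>G\<subseteq>carrier M. finite G \<and>
        (\<forall>x\<in>carrier M. \<exists>c\<in>G \<rightarrow> carrier R. x = (\<Oplus>\<^bsub>M\<^esub>g\<in>G. c g \<odot>\<^bsub>M\<^esub> g)))"

end

theory Submission
  imports Defs
begin

text \<open>
  The component \<open>S\<^sub>a\<close> has the \<open>k\<close>-basis of monomials \<open>x\<^sup>l\<close> with \<open>l\<close> in the set \<open>E\<^sub>a\<close> of exponents of
  degree \<open>a\<close>. Everything therefore takes place among exponents: it is enough to find a finite set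
  \<open>G \<subseteq> E\<^sub>a\<close> with \<open>E\<^sub>a = G + E\<^sub>0\<close>, because then the monomials \<open>x\<^sup>g\<close>, \<open>g \<in> G\<close>, generate \<open>S\<^sub>a\<close> over \<open>S\<^sub>0\<close>:
  each \<open>x\<^sup>l\<close> in \<open>S\<^sub>a\<close> is a product \<open>x\<^bsup>l - g\<^esup> x\<^sup>g\<close> with \<open>x\<^bsup>l - g\<^esup> \<in> S\<^sub>0\<close>.

  Since the degree is additive, the difference of two exponents of degree \<open>a\<close> automatically has
  degree \<open>0\<close>. The only obstruction to \<open>l - g \<in> E\<^sub>0\<close> is thus the sign of its first \<open>r\<close> coordinates; the
  invertible variables impose no condition. So \<open>G\<close> has only to contain, for every \<open>l \<in> E\<^sub>a\<close>, some \<open>g\<close>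
  lying below \<open>l\<close> in the first \<open>r\<close> coordinates, and such a finite \<open>G\<close> exists by Dickson's lemma in
  \<open>\<nat>\<^sup>r\<close>, applied to the projection of \<open>E\<^sub>a\<close>.
\<close>

section \<open>Dickson's lemma\<close>

text \<open>
  Induction on the number of coordinates. A finite set \<open>G\<close> that is good for the coordinates in \<open>I\<close>
  also handles, with a further coordinate \<open>i\<close>, all points whose coordinate at \<open>i\<close> is at least \<open>N\<close>, an
  upper bound for that coordinate on \<open>G\<close>. The remaining points lie on finitely many slices on
  which the coordinate \<open>i\<close> is constant, and on each slice the induction hypothesis applies again.
  The coordinates are functions \<open>f i\<close> on an arbitrary type, so that the lemma applies to exponent
  vectors compared in some of their coordinates only.
\<close>

lemma dickson:
  fixes f :: "'i \<Rightarrow> 'a \<Rightarrow> nat"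
  assumes "finite I"
  shows "\<exists>G\<subseteq>E. finite G \<and> (\<forall>l\<in>E. \<exists>g\<in>G. \<forall>i\<in>I. f i g \<le> f i l)"
  using assms
proof (induction I arbitrary: E rule: finite_induct)
  case empty
  show ?case
  proof (cases "E = {}")
    case False
    then obtain e where "e \<in> E" by blast
    then show ?thesis by (intro exI[of _ "{e}"]) auto
  qed auto
next
  case (insert i I)
  obtain G where G: "G \<subseteq> E" "finite G" "\<forall>l\<in>E. \<exists>g\<in>G. \<forall>j\<in>I. f j g \<le> f j l"
    using insert.IH by blast
  obtain N where N: "\<forall>g\<in>G. f i g \<le> N"
    using G(2) finite_nat_set_iff_bounded_le[of "f i ` G"] by auto
  have "\<forall>k. \<exists>H. H \<subseteq> {l\<in>E. f i l = k} \<and> finite H \<and>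
          (\<forall>l\<in>{l\<in>E. f i l = k}. \<exists>g\<in>H. \<forall>j\<in>I. f j g \<le> f j l)"
    by (intro allI insert.IH)
  from choice[OF this] obtain H where
    "\<forall>k. H k \<subseteq> {l\<in>E. f i l = k} \<and> finite (H k) \<and>
      (\<forall>l\<in>{l\<in>E. f i l = k}. \<exists>g\<in>H k. \<forall>j\<in>I. f j g \<le> f j l)" ..
  then have H: "H k \<subseteq> {l\<in>E. f i l = k}" "finite (H k)"
      "\<forall>l\<in>{l\<in>E. f i l = k}. \<exists>g\<in>H k. \<forall>j\<in>I. f j g \<le> f j l" for k
    by simp_all
  define K where "K = G \<union> (\<Union>k<N. H k)"
  have "\<forall>l\<in>E. \<exists>g\<in>K. \<forall>j\<in>insert i I. f j g \<le> f j l"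
  proof
    fix l assume l: "l \<in> E"
    show "\<exists>g\<in>K. \<forall>j\<in>insert i I. f j g \<le> f j l"
    proof (cases "f i l < N")
      case True
      obtain g where g: "g \<in> H (f i l)" "\<forall>j\<in>I. f j g \<le> f j l"
        using H(3)[of "f i l"] l by blast
      moreover have "f i g = f i l"
        using H(1) g(1) by blast
      ultimately show ?thesis
        using True by (intro bexI[of _ g]) (auto simp: K_def)
    next
      case False
      obtain g where g: "g \<in> G" "\<forall>j\<in>I. f j g \<le> f j l"
        using G(3) l by blast
      moreover have "f i g \<le> f i l"
        using N g(1) False by force
      ultimately show ?thesis
        by (intro bexI[of _ g]) (auto simp: K_def)
    qed
  qed
  moreover have "K \<subseteq> E"
    unfolding K_def using G(1) H(1) by blast
  moreover have "finite K"
    unfolding K_def using G(2) H(2) by blast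
  ultimately show ?case by (intro exI[of _ K] conjI)
qed

section \<open>Exponents of a given degree\<close>

definition exponents_of_degree ::
    "nat \<Rightarrow> nat \<Rightarrow> nat \<Rightarrow> nat \<Rightarrow> (nat \<Rightarrow> nat) \<Rightarrow> (nat \<Rightarrow> nat \<Rightarrow> int) \<Rightarrow> (nat \<Rightarrow> int) \<Rightarrow>
     (nat \<Rightarrow>\<^sub>0 int) set" where
  "exponents_of_degree r s p t d L a =
     {l \<in> exponents r s. weight_degree (r + s) p t d L l = a}"

lemma exponents_add: "l \<in> exponents r s \<Longrightarrow> m \<in> exponents r s \<Longrightarrow> l + m \<in> exponents r s"
  unfolding exponents_def using Poly_Mapping.keys_add[of l m] by (auto simp: lookup_add)

text \<open>
  Nonnegativity is demanded in the first \<open>r\<close> coordinates only, which is why a comparison there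
  suffices for \<open>l - g\<close> to be an exponent again.
\<close>

lemma exponents_diff:
  assumes "l \<in> exponents r s" "g \<in> exponents r s"
    and "\<forall>i<r. Poly_Mapping.lookup g i \<le> Poly_Mapping.lookup l i"
  shows "l - g \<in> exponents r s"
proof -
  have "Poly_Mapping.keys (l - g) \<subseteq> Poly_Mapping.keys l \<union> Poly_Mapping.keys g"
    by (auto simp: in_keys_iff lookup_minus)
  then show ?thesis
    using assms unfolding exponents_def by (auto simp: lookup_minus)
qed

lemma weight_degree_eq_iff:
  "weight_degree n p t d L l = weight_degree n p t d L m \<longleftrightarrow>
     (\<forall>j<p + t. (\<Sum>i<n. L j i * Poly_Mapping.lookup l i) mod int (modulus p d j) =
                (\<Sum>i<n. L j i * Poly_Mapping.lookup m i) mod int (modulus p d j))"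
  unfolding weight_degree_def weight_class_def restrict_def fun_eq_iff by auto

lemma weight_degree_zero: "weight_degree n p t d L 0 = \<one>\<^bsub>weight_group p t d\<^esub>"
  by (simp add: weight_degree_def weight_class_def weight_group_def restrict_def fun_eq_iff)

lemma weight_degree_add:
  assumes "weight_degree n p t d L m = \<one>\<^bsub>weight_group p t d\<^esub>"
  shows "weight_degree n p t d L (m + l) = weight_degree n p t d L l"
  unfolding weight_degree_eq_iff
proof (intro allI impI)
  fix j assume j: "j < p + t"
  let ?\<phi> = "\<lambda>l. \<Sum>i<n. L j i * Poly_Mapping.lookup l i"
  have "weight_degree n p t d L m = weight_degree n p t d L 0"
    using assms by (simp only: weight_degree_zero)
  then have "?\<phi> m mod int (modulus p d j) = ?\<phi> 0 mod int (modulus p d j)"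
    using j unfolding weight_degree_eq_iff by blast
  then have "(?\<phi> m + ?\<phi> l) mod int (modulus p d j) = (?\<phi> 0 + ?\<phi> l) mod int (modulus p d j)"
    by (intro mod_add_cong refl)
  then show "?\<phi> (m + l) mod int (modulus p d j) = ?\<phi> l mod int (modulus p d j)"
    by (simp add: lookup_add distrib_left sum.distrib)
qed

lemma weight_degree_diff:
  assumes "weight_degree n p t d L l = weight_degree n p t d L g"
  shows "weight_degree n p t d L (l - g) = \<one>\<^bsub>weight_group p t d\<^esub>"
  unfolding weight_degree_zero[of n p t d L, symmetric] weight_degree_eq_iff
proof (intro allI impI)
  fix j assume j: "j < p + t"
  let ?\<phi> = "\<lambda>l. \<Sum>i<n. L j i * Poly_Mapping.lookup l i"
  have "?\<phi> l mod int (modulus p d j) = ?\<phi> g mod int (modulus p d j)"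
    using assms j unfolding weight_degree_eq_iff by blast
  then have "(?\<phi> l - ?\<phi> g) mod int (modulus p d j) = (?\<phi> g - ?\<phi> g) mod int (modulus p d j)"
    by (intro mod_diff_cong refl)
  then show "?\<phi> (l - g) mod int (modulus p d j) = ?\<phi> 0 mod int (modulus p d j)"
    by (simp add: lookup_minus right_diff_distrib sum_subtractf)
qed

lemma zero_in_exponents_of_degree:
  "0 \<in> exponents_of_degree r s p t d L \<one>\<^bsub>weight_group p t d\<^esub>"
  by (simp add: exponents_of_degree_def weight_degree_zero exponents_def)

lemma exponents_of_degree_add:
  assumes "m \<in> exponents_of_degree r s p t d L \<one>\<^bsub>weight_group p t d\<^esub>"
    and "l \<in> exponents_of_degree r s p t d L a"
  shows "m + l \<in> exponents_of_degree r s p t d L a"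
  using assms by (simp add: exponents_of_degree_def exponents_add weight_degree_add)

text \<open>
  This is where finiteness comes from. Passing to natural numbers loses nothing, because
  the coordinates compared are nonnegative.
\<close>

lemma finite_exponent_generators:
  "\<exists>G\<subseteq>exponents_of_degree r s p t d L a. finite G \<and>
     (\<forall>l\<in>exponents_of_degree r s p t d L a. \<exists>g\<in>G.
        l - g \<in> exponents_of_degree r s p t d L \<one>\<^bsub>weight_group p t d\<^esub>)"
proof -
  let ?E = "exponents_of_degree r s p t d L a"
  obtain G where G: "G \<subseteq> ?E" "finite G"
      "\<forall>l\<in>?E. \<exists>g\<in>G. \<forall>i\<in>{..<r}. nat (Poly_Mapping.lookup g i) \<le> nat (Poly_Mapping.lookup l i)"
    using dickson[of "{..<r}" ?E "\<lambda>i l. nat (Poly_Mapping.lookup l i)"] by auto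
  have "\<exists>g\<in>G. l - g \<in> exponents_of_degree r s p t d L \<one>\<^bsub>weight_group p t d\<^esub>"
    if l: "l \<in> ?E" for l
  proof -
    obtain g where g: "g \<in> G" "\<forall>i<r. nat (Poly_Mapping.lookup g i) \<le> nat (Poly_Mapping.lookup l i)"
      using G(3) l by blast
    then have "g \<in> ?E" using G(1) by blast
    moreover have "\<forall>i<r. Poly_Mapping.lookup g i \<le> Poly_Mapping.lookup l i"
      using g(2) l nat_le_eq_zle by (fastforce simp: exponents_of_degree_def exponents_def)
    ultimately show ?thesis
      using l g(1) by (intro bexI[of _ g])
        (auto simp: exponents_of_degree_def intro: exponents_diff weight_degree_diff)
  qed
  then show ?thesis using G(1,2) by blast
qed

section \<open>The graded components and their module structure\<close>

lemma sum_monomials: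
  "(\<Sum>l\<in>Poly_Mapping.keys f. Poly_Mapping.single l (Poly_Mapping.lookup f l)) = f"
  by (rule poly_mapping_eqI) (simp add: lookup_sum lookup_single when_def in_keys_iff)

lemma keys_sum_subset:
  assumes "\<And>i. i \<in> I \<Longrightarrow> Poly_Mapping.keys (f i) \<subseteq> E"
  shows "Poly_Mapping.keys (\<Sum>i\<in>I. f i) \<subseteq> E"
proof
  fix l assume "l \<in> Poly_Mapping.keys (\<Sum>i\<in>I. f i)"
  then have "(\<Sum>i\<in>I. Poly_Mapping.lookup (f i) l) \<noteq> 0"
    by (simp add: in_keys_iff lookup_sum)
  then obtain i where "i \<in> I" "Poly_Mapping.lookup (f i) l \<noteq> 0"
    by (meson sum.neutral)
  then show "l \<in> E"
    using assms by (auto simp: in_keys_iff subset_iff)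
qed

text \<open>
  Describing \<open>S\<^sub>a\<close> by supports instead of linear combinations turns all closure properties of the
  graded components into statements about sets of exponents.
\<close>

lemma graded_component_eq:
  "graded_component r s p t d L a =
     {f :: (nat \<Rightarrow>\<^sub>0 int) \<Rightarrow>\<^sub>0 'k::field.
        Poly_Mapping.keys f \<subseteq> exponents_of_degree r s p t d L a}"
proof -
  let ?E = "exponents_of_degree r s p t d L a"
  let ?B = "{Poly_Mapping.single l 1 | l. l \<in> ?E} :: ((nat \<Rightarrow>\<^sub>0 int) \<Rightarrow>\<^sub>0 'k) set"
  interpret V: Modules.module "\<lambda>(c::'k) (f :: (nat \<Rightarrow>\<^sub>0 int) \<Rightarrow>\<^sub>0 'k). Poly_Mapping.single 0 c * f"
    by unfold_locales (simp_all add: algebra_simps single_add mult_single flip: mult.assoc)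
  have "V.subspace {f. Poly_Mapping.keys f \<subseteq> ?E}"
  proof (rule V.subspaceI)
    fix f g :: "(nat \<Rightarrow>\<^sub>0 int) \<Rightarrow>\<^sub>0 'k"
    assume "f \<in> {f. Poly_Mapping.keys f \<subseteq> ?E}" "g \<in> {f. Poly_Mapping.keys f \<subseteq> ?E}"
    then show "f + g \<in> {f. Poly_Mapping.keys f \<subseteq> ?E}"
      using Poly_Mapping.keys_add[of f g] by auto
  next
    fix c :: 'k and f :: "(nat \<Rightarrow>\<^sub>0 int) \<Rightarrow>\<^sub>0 'k"
    assume "f \<in> {f. Poly_Mapping.keys f \<subseteq> ?E}"
    then show "Poly_Mapping.single 0 c * f \<in> {f. Poly_Mapping.keys f \<subseteq> ?E}"
      using keys_mult[of "Poly_Mapping.single 0 c" f] by (auto split: if_splits)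
  qed simp
  moreover have "?B \<subseteq> {f. Poly_Mapping.keys f \<subseteq> ?E}" by auto
  ultimately have "V.span ?B \<subseteq> {f. Poly_Mapping.keys f \<subseteq> ?E}"
    by (intro V.span_minimal)
  moreover have "f \<in> V.span ?B" if f: "Poly_Mapping.keys f \<subseteq> ?E" for f :: "(nat \<Rightarrow>\<^sub>0 int) \<Rightarrow>\<^sub>0 'k"
  proof -
    have "Poly_Mapping.single l (Poly_Mapping.lookup f l) \<in> V.span ?B" if "l \<in> Poly_Mapping.keys f" for l
    proof -
      have "Poly_Mapping.single l (1::'k) \<in> V.span ?B"
        using f that by (intro V.span_base) blast
      from V.span_scale[OF this, of "Poly_Mapping.lookup f l"] show ?thesis
        by (simp add: mult_single)
    qed
    then have "(\<Sum>l\<in>Poly_Mapping.keys f. Poly_Mapping.single l (Poly_Mapping.lookup f l)) \<in> V.span ?B"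
      by (rule V.span_sum)
    then show ?thesis by (simp add: sum_monomials)
  qed
  ultimately have "V.span ?B = {f. Poly_Mapping.keys f \<subseteq> ?E}" by blast
  then show ?thesis
    by (simp add: graded_component_def exponents_of_degree_def)
qed

lemma graded_component_mult:
  assumes "f \<in> graded_component r s p t d L \<one>\<^bsub>weight_group p t d\<^esub>"
    and "g \<in> graded_component r s p t d L a"
  shows "f * g \<in> graded_component r s p t d L a"
  using assms keys_mult[of f g] exponents_of_degree_add
  unfolding graded_component_eq by blast

lemma graded_component_add:
  "f \<in> graded_component r s p t d L a \<Longrightarrow> g \<in> graded_component r s p t d L a \<Longrightarrow>
   f + g \<in> graded_component r s p t d L a"
  using Poly_Mapping.keys_add[of f g] unfolding graded_component_eq by blast

lemma graded_component_uminus: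
  "f \<in> graded_component r s p t d L a \<Longrightarrow> - f \<in> graded_component r s p t d L a"
  unfolding graded_component_eq by (auto simp: in_keys_iff subset_iff)

lemma zero_in_graded_component: "0 \<in> graded_component r s p t d L a"
  by (simp add: graded_component_eq)

lemma one_in_graded_component: "1 \<in> graded_component r s p t d L \<one>\<^bsub>weight_group p t d\<^esub>"
  using zero_in_exponents_of_degree by (simp add: graded_component_eq)

lemmas graded_component_closed =
  graded_component_mult graded_component_add zero_in_graded_component one_in_graded_component

lemma graded_component_inverse:
  "f \<in> graded_component r s p t d L a \<Longrightarrow> \<exists>g\<in>graded_component r s p t d L a. f + g = 0"
  by (rule bexI[OF _ graded_component_uminus]) simp_all

lemma cring_degree_zero_ring:
  "cring (degree_zero_ring r s p t d L :: ((nat \<Rightarrow>\<^sub>0 int) \<Rightarrow>\<^sub>0 'k::field) ring)"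
  by (intro cringI abelian_groupI comm_monoidI)
     (simp_all add: degree_zero_ring_def laurent_ring_def ring_of_type_algebra_def
       graded_component_closed graded_component_inverse algebra_simps)

lemma module_graded_module:
  "Module.module (degree_zero_ring r s p t d L :: ((nat \<Rightarrow>\<^sub>0 int) \<Rightarrow>\<^sub>0 'k::field) ring)
     (graded_module r s p t d L a)"
  by (intro moduleI[OF cring_degree_zero_ring] abelian_groupI)
     (simp_all add: degree_zero_ring_def graded_module_def laurent_ring_def
       ring_of_type_algebra_def graded_component_closed graded_component_inverse
       algebra_simps)

lemma finsum_graded_module:
  fixes f :: "'i \<Rightarrow> (nat \<Rightarrow>\<^sub>0 int) \<Rightarrow>\<^sub>0 'k::field"
  assumes "finite I" and "f \<in> I \<rightarrow> graded_component r s p t d L a"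
  shows "(\<Oplus>\<^bsub>graded_module r s p t d L a\<^esub>i\<in>I. f i) = (\<Sum>i\<in>I. f i)"
proof -
  interpret M: Module.module
      "degree_zero_ring r s p t d L :: ((nat \<Rightarrow>\<^sub>0 int) \<Rightarrow>\<^sub>0 'k) ring" "graded_module r s p t d L a"
    by (rule module_graded_module)
  show ?thesis
    using assms
  proof (induction I rule: finite_induct)
    case empty
    then show ?case
      unfolding M.finsum_empty
      by (simp add: graded_module_def laurent_ring_def ring_of_type_algebra_def)
  next
    case (insert i I)
    then have "(\<Oplus>\<^bsub>graded_module r s p t d L a\<^esub>i\<in>insert i I. f i) =
        f i \<oplus>\<^bsub>graded_module r s p t d L a\<^esub> (\<Oplus>\<^bsub>graded_module r s p t d L a\<^esub>i\<in>I. f i)"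
      by (intro M.finsum_insert) (auto simp: graded_module_def)
    with insert show ?case
      by (simp add: graded_module_def laurent_ring_def ring_of_type_algebra_def)
  qed
qed

section \<open>Finite generation\<close>

text \<open>
  The generators are the monomials \<open>x\<^sup>g\<close>, \<open>g \<in> G\<close>. Choose for every exponent \<open>l\<close> of degree \<open>a\<close> some
  \<open>\<gamma> l \<in> G\<close> with \<open>l - \<gamma> l\<close> of degree \<open>0\<close>; the coefficient of \<open>x\<^sup>g\<close> in \<open>f\<close> then collects the terms
  \<open>c x\<^bsup>l - g\<^esup>\<close> over the terms \<open>c x\<^sup>l\<close> of \<open>f\<close> with \<open>\<gamma> l = g\<close>.
\<close>

lemma finitely_generated_graded_module:
  "finitely_generated_module
     (degree_zero_ring r s p t d L :: ((nat \<Rightarrow>\<^sub>0 int) \<Rightarrow>\<^sub>0 'k::field) ring)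
     (graded_module r s p t d L a)"
proof -
  let ?E = "exponents_of_degree r s p t d L a"
  let ?Z = "exponents_of_degree r s p t d L \<one>\<^bsub>weight_group p t d\<^esub>"
  let ?R = "degree_zero_ring r s p t d L :: ((nat \<Rightarrow>\<^sub>0 int) \<Rightarrow>\<^sub>0 'k) ring"
  let ?M = "graded_module r s p t d L a
    :: ((nat \<Rightarrow>\<^sub>0 int) \<Rightarrow>\<^sub>0 'k, (nat \<Rightarrow>\<^sub>0 int) \<Rightarrow>\<^sub>0 'k) module"
  let ?X = "\<lambda>g. Poly_Mapping.single g 1 :: (nat \<Rightarrow>\<^sub>0 int) \<Rightarrow>\<^sub>0 'k"
  have carrier_M: "carrier ?M = {f. Poly_Mapping.keys f \<subseteq> ?E}"
    by (simp add: graded_module_def graded_component_eq)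
  have carrier_R: "carrier ?R = {f. Poly_Mapping.keys f \<subseteq> ?Z}"
    by (simp add: degree_zero_ring_def graded_component_eq)
  have smult: "c \<odot>\<^bsub>?M\<^esub> f = c * f" for c f
    by (simp add: graded_module_def laurent_ring_def ring_of_type_algebra_def)
  obtain G where G: "G \<subseteq> ?E" "finite G" and "\<forall>l\<in>?E. \<exists>g\<in>G. l - g \<in> ?Z"
    using finite_exponent_generators[of r s p t d L a] by auto
  then obtain \<gamma> where \<gamma>: "\<And>l. l \<in> ?E \<Longrightarrow> \<gamma> l \<in> G" "\<And>l. l \<in> ?E \<Longrightarrow> l - \<gamma> l \<in> ?Z"
    by metis
  have inj: "inj_on ?X G"
    by (rule inj_onI, drule arg_cong[of _ _ Poly_Mapping.keys]) simp
  have generates: "\<exists>c\<in>?X ` G \<rightarrow> carrier ?R. f = (\<Oplus>\<^bsub>?M\<^esub>b\<in>?X ` G. c b \<odot>\<^bsub>?M\<^esub> b)"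
    if f: "f \<in> carrier ?M" for f
  proof -
    have f_keys: "Poly_Mapping.keys f \<subseteq> ?E" using f carrier_M by simp
    define C where
      "C g = (\<Sum>l\<in>{l\<in>Poly_Mapping.keys f. \<gamma> l = g}.
         Poly_Mapping.single (l - g) (Poly_Mapping.lookup f l))" for g
    have C: "Poly_Mapping.keys (C g) \<subseteq> ?Z" for g
      unfolding C_def using f_keys \<gamma>(2) by (intro keys_sum_subset) auto
    \<comment> \<open>A linear combination is indexed by the generators, not by their exponents; distinct
      exponents give distinct monomials, so the coefficients can be transported along \<open>g \<mapsto> x\<^sup>g\<close>.\<close>
    define c where "c b = C (the_inv_into G ?X b)" for b
    have c: "c (?X g) = C g" if "g \<in> G" for g
      using the_inv_into_f_f[OF inj that] by (simp add: c_def)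
    have c_carrier: "c \<in> ?X ` G \<rightarrow> carrier ?R"
      using C by (auto simp: c_def carrier_R)
    have "c b * b \<in> graded_component r s p t d L a" if "b \<in> ?X ` G" for b
      using that G(1) C[THEN subsetD]
      by (intro graded_component_mult) (auto simp: c graded_component_eq)
    then have "(\<Oplus>\<^bsub>?M\<^esub>b\<in>?X ` G. c b * b) = (\<Sum>b\<in>?X ` G. c b * b)"
      using G(2) by (intro finsum_graded_module) auto
    also have "\<dots> = (\<Sum>g\<in>G. C g * ?X g)"
      using inj by (simp add: sum.reindex c)
    also have "\<dots> = (\<Sum>g\<in>G. \<Sum>l\<in>{l\<in>Poly_Mapping.keys f. \<gamma> l = g}.
        Poly_Mapping.single l (Poly_Mapping.lookup f l))"
      by (simp add: C_def sum_distrib_right mult_single)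
    also have "\<dots> = (\<Sum>l\<in>Poly_Mapping.keys f. Poly_Mapping.single l (Poly_Mapping.lookup f l))"
      using f_keys \<gamma>(1) G(2) by (intro sum.group) auto
    finally have "f = (\<Oplus>\<^bsub>?M\<^esub>b\<in>?X ` G. c b \<odot>\<^bsub>?M\<^esub> b)"
      by (simp add: smult sum_monomials)
    with c_carrier show ?thesis by blast
  qed
  have "?X ` G \<subseteq> carrier ?M"
    using G(1) by (auto simp: carrier_M)
  moreover have "finite (?X ` G)"
    using G(2) by simp
  ultimately have "\<exists>B\<subseteq>carrier ?M. finite B \<and>
      (\<forall>f\<in>carrier ?M. \<exists>c\<in>B \<rightarrow> carrier ?R. f = (\<Oplus>\<^bsub>?M\<^esub>b\<in>B. c b \<odot>\<^bsub>?M\<^esub> b))"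
    using generates by (intro exI[of _ "?X ` G"] conjI ballI)
  then show ?thesis
    unfolding finitely_generated_module_def using module_graded_module by (intro conjI)
qed

theorem theorem8p7:
  fixes r s p t :: nat
    and d :: "nat \<Rightarrow> nat"
    and \<eta> :: "nat \<Rightarrow> nat \<Rightarrow> int"
    and L :: "nat \<Rightarrow> nat \<Rightarrow> int"
    and Q :: "(nat \<Rightarrow> int) set"
  assumes orders: "\<forall>j<t. 0 < d j"
    and weights: "\<forall>i<r + s. \<eta> i \<in> carrier (weight_group p t d)"
    and L_columns: "\<forall>i<r + s. \<eta> i = weight_class p t d (\<lambda>j. L j i)"
    and faithful:
      "faithful_action
         (acting_group p t d :: (nat \<Rightarrow> 'k::{alg_closed_field, field_char_0}) monoid)
         (affine_torus_space r s) (diagonal_action r s p t \<eta>)"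
    and Q_def: "Q = weight_degree (r + s) p t d L ` exponents r s"
  shows "\<forall>a\<in>Q. finitely_generated_module
           (degree_zero_ring r s p t d L :: ((nat \<Rightarrow>\<^sub>0 int) \<Rightarrow>\<^sub>0 'k) ring)
           (graded_module r s p t d L a)"
  by (intro ballI finitely_generated_graded_module)

end
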